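(* Let $x,\nu \in \mathbb{C}$. Given complex sequences $S=(S_n)_{n \geqslant 1}$ and $T=(T_n)_{n \geqslant 1}$ related by the inversion formulae $S = B(x,\nu) \cdot T \Leftrightarrow T = A(x,\nu) \cdot S$, the exponential generating function $\mathfrak{G}_S^*$ of the sequence $S$ can be expressed by $$ \mathfrak{G}_S^*(z) = \exp(z) \cdot \sum_{k \geqslant 1} (-1)^k T_k \, \frac{z^k}{k!} \, \Phi(k\nu;k;-x \, z), \qquad z \in \mathbb{C}, $$ where $\Phi(\alpha;\beta;\cdot)$ denotes the Confluent Hypergeometric function with parameters $\alpha$, $\beta \notin -\mathbb{N}$.
   Context: $A(x,\nu)$ and $B(x,\nu)$ are the infinite lower-triangular matrices, indexed by integers $n,k\geqslant 1$, with entries $$A_{n,k}(x,\nu) = (-1)^k\binom{n}{k}F(k-n,-n\nu;-n;x), \qquad B_{n,k}(x,\nu) = (-1)^k\binom{n}{k}F(k-n,k\nu;k;x)$$ for $1 \leqslant k \leqslant n$ (zero for $k>n$), where $F$ is the Gauss hypergeometric function, which here reduces to the polynomials $F(k-n,-n\nu;-n;x) = \sum_{m=0}^{n-k} \frac{(k-n)_m(-n\nu)_m}{(-n)_m \, m!} x^m$ and $F(k-n,k\nu;k;x) = \sum_{m=0}^{n-k} \frac{(k-n)_m(k\nu)_m}{(k)_m \, m!} x^m$, with the Pochhammer symbol $(c)_m = c(c+1)\cdots(c+m-1)$, $(c)_0=1$. These matrices are inverse of each other. The exponential generating function of $S$ is $\mathfrak{G}_S^*(z) = \sum_{n\geqslant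 1} S_n \frac{z^n}{n!}$, and $\Phi(\alpha;\beta;Z) = \sum_{m\geqslant 0} \frac{(\alpha)_m}{(\beta)_m}\frac{Z^m}{m!}$. *)

theory Defs
  imports "HOL-Analysis.Analysis" "HOL-Computational_Algebra.Formal_Power_Series"
begin

text \<open>
  The terminating Gauss series \<open>F(-N, b; c; x)\<close>, truncated at the point from which
  \<open>pochhammer (-N) m\<close> vanishes. For \<open>c = -n\<close> with \<open>n > N\<close> the denominators \<open>pochhammer c m\<close> are
  nonzero for all \<open>m \<le> N\<close>, although they vanish for \<open>m > n\<close>.
\<close>

definition gauss_F :: "nat \<Rightarrow> complex \<Rightarrow> complex \<Rightarrow> complex \<Rightarrow> complex" where
  "gauss_F N b c x =
     (\<Sum>m\<le>N. pochhammer (- of_nat N) m * pochhammer b m / (pochhammer c m * fact m) * x ^ m)"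

text \<open>All matrices and sequences are indexed by integers \<open>\<ge> 1\<close>; values at index \<open>0\<close> are never used.\<close>

definition A_mat :: "complex \<Rightarrow> complex \<Rightarrow> nat \<Rightarrow> nat \<Rightarrow> complex" where
  "A_mat x \<nu> n k =
     (if k \<le> n
      then (-1) ^ k * of_nat (n choose k) * gauss_F (n - k) (- of_nat n * \<nu>) (- of_nat n) x
      else 0)"

definition B_mat :: "complex \<Rightarrow> complex \<Rightarrow> nat \<Rightarrow> nat \<Rightarrow> complex" where
  "B_mat x \<nu> n k =
     (if k \<le> n
      then (-1) ^ k * of_nat (n choose k) * gauss_F (n - k) (of_nat k * \<nu>) (of_nat k) x
      else 0)"

text \<open>Product of an infinite lower-triangular matrix with a column vector; row \<open>n\<close> stops at column \<open>n\<close>.\<close>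

definition lt_mat_vec :: "(nat \<Rightarrow> nat \<Rightarrow> complex) \<Rightarrow> (nat \<Rightarrow> complex) \<Rightarrow> nat \<Rightarrow> complex" where
  "lt_mat_vec M v n = (\<Sum>k=1..n. M n k * v k)"

definition conf_hyp :: "complex \<Rightarrow> complex \<Rightarrow> complex \<Rightarrow> complex" where
  "conf_hyp \<alpha> \<beta> Z = (\<Sum>m. pochhammer \<alpha> m / pochhammer \<beta> m * (Z ^ m / fact m))"

text \<open>
  For arbitrary sequences the series below need not converge away from \<open>z = 0\<close>, so each of the two
  sides is given both as a formal power series in \<open>z\<close> and by the terms of a numerical series at a
  point \<open>z\<close>. Position \<open>j\<close> of a numerical series holds the term with index \<open>j + 1\<close>.
\<close>

definition fps_egf :: "(nat \<Rightarrow> complex) \<Rightarrow> complex fps" where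
  "fps_egf S = Abs_fps (\<lambda>n. if n = 0 then 0 else S n / fact n)"

definition egf_term :: "(nat \<Rightarrow> complex) \<Rightarrow> complex \<Rightarrow> nat \<Rightarrow> complex" where
  "egf_term S z j = (let n = Suc j in S n * z ^ n / fact n)"

definition egf :: "(nat \<Rightarrow> complex) \<Rightarrow> complex \<Rightarrow> complex" where
  "egf S z = (\<Sum>j. egf_term S z j)"

definition kummer_term ::
    "complex \<Rightarrow> complex \<Rightarrow> (nat \<Rightarrow> complex) \<Rightarrow> complex \<Rightarrow> nat \<Rightarrow> complex" where
  "kummer_term x \<nu> T z j =
     (let k = Suc j
      in (-1) ^ k * T k * (z ^ k / fact k) * conf_hyp (of_nat k * \<nu>) (of_nat k) (- x * z))"

text \<open>\<open>fps_hypergeo [\<alpha>] [\<beta>] c\<close> is the expansion of \<open>\<Phi>(\<alpha>; \<beta>; c z)\<close> in powers of \<open>z\<close>.\<close>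

definition fps_kummer_term ::
    "complex \<Rightarrow> complex \<Rightarrow> (nat \<Rightarrow> complex) \<Rightarrow> nat \<Rightarrow> complex fps" where
  "fps_kummer_term x \<nu> T j =
     (let k = Suc j
      in fps_const ((-1) ^ k * T k / fact k) * fps_X ^ k * fps_hypergeo [of_nat k * \<nu>] [of_nat k] (- x))"

end

theory Submission
  imports Defs
begin

text \<open>
  Put \<open>s\<^sub>n = S\<^sub>n / n!\<close> and \<open>t\<^sub>k = (-1)\<^sup>k T\<^sub>k / k!\<close>. Up to these normalizations the entry of \<open>B\<close> in
  position \<open>(n, k)\<close> is the coefficient of \<open>z^(n - k)\<close> in \<open>exp z \<cdot> \<Phi>(k\<nu>; k; -xz)\<close>, because a terminating
  Gauss series is a Cauchy product of the exponential series with a confluent one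
  (\<open>gauss_F_eq_coeff\<close>). So \<open>S = B T\<close> says exactly that the series
  \<open>\<Sum> t\<^sub>k z\<^sup>k exp z \<Phi>(k\<nu>; k; -xz)\<close>, expanded in powers of \<open>z\<close>, has the coefficients \<open>s\<^sub>n\<close>; this is the
  formal identity. Likewise \<open>A\<close> is built from \<open>exp (-z) \<Phi>(-n\<nu>; -n; xz)\<close>. In a product of the two kinds
  of series the exponentials cancel, and what is left of the orthogonality of rows and columns is a
  Vandermonde convolution (\<open>exp_kummer_dual_mult_nth\<close>). Hence either of the relations between \<open>S\<close>
  and \<open>T\<close> implies the other.

  For the numerical series at a point \<open>z\<close>, nothing guarantees absolute convergence. The argument
  rests on the fact that the partial sums of the two series, the second one multiplied by \<open>exp z\<close>,
  differ by a quantity tending to \<open>0\<close> as soon as the terms \<open>t\<^sub>k z\<^sup>k\<close> tend to \<open>0\<close>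
  (\<open>convolution_partial_sums\<close>): the coefficients of \<open>exp z \<Phi>(k\<nu>; k; -xz)\<close> are bounded by
  \<open>C\<^sup>m / m!\<close> with \<open>C\<close> independent of \<open>k\<close>, so that truncating the series costs only a convolution of a
  null sequence with a summable one.

  It remains to see that convergence of either series forces \<open>t\<^sub>k z\<^sup>k \<rightarrow> 0\<close>. On the confluent side
  this follows from \<open>\<Phi>(k\<nu>; k; -xz) \<rightarrow> exp (-\<nu>xz) \<noteq> 0\<close> (\<open>conf_hyp_tendsto_exp\<close>). On the power series
  side one applies the inverse matrix to the null sequence \<open>s\<^sub>n z\<^sup>n\<close>; its entries obey a bound of
  the same shape (\<open>norm_exp_kummer_dual_le\<close>), so the image is again a null sequence.
\<close>

unbundle no vec_syntax
unbundle fps_syntax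

section \<open>The matrices as coefficients of power series\<close>

definition exp_kummer :: "complex \<Rightarrow> complex \<Rightarrow> nat \<Rightarrow> complex fps" where
  "exp_kummer x \<nu> k = fps_exp 1 * fps_hypergeo [of_nat k * \<nu>] [of_nat k] (- x)"

text \<open>
  The lower parameter \<open>-n\<close> makes the denominators of the confluent series vanish beyond degree \<open>n\<close>.
  Division by zero being zero, the series is cut off there and becomes a polynomial, so that bounds
  on its coefficients can be stated in every degree.
\<close>

definition exp_kummer_dual :: "complex \<Rightarrow> complex \<Rightarrow> nat \<Rightarrow> complex fps" where
  "exp_kummer_dual x \<nu> n = fps_exp (-1) * fps_hypergeo [- of_nat n * \<nu>] [- of_nat n] x"

lemma hypergeo_1_1_nth:
  "fps_hypergeo [b] [c] y $ m = pochhammer b m / pochhammer c m * y ^ m / fact m"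
  by (simp add: field_simps)

text \<open>
  Expanding \<open>(-N)\<^sub>m = (-1)\<^sup>m N! / (N - m)!\<close> turns the terminating Gauss series into a Cauchy product.
  The sign \<open>\<epsilon> = 1\<close> serves the matrix \<open>B\<close> and \<open>\<epsilon> = -1\<close> the matrix \<open>A\<close>; choosing opposite signs is what
  makes the exponentials cancel in the product of the two matrices.
\<close>

lemma gauss_F_eq_coeff:
  fixes \<epsilon> :: complex
  assumes "\<epsilon> * \<epsilon> = 1"
  shows "gauss_F N b c x = fact N * \<epsilon> ^ N * (fps_exp \<epsilon> * fps_hypergeo [b] [c] (- \<epsilon> * x)) $ N"
proof -
  have "fact N * \<epsilon> ^ N * (fps_hypergeo [b] [c] (- \<epsilon> * x) $ m * fps_exp \<epsilon> $ (N - m))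
      = pochhammer (- of_nat N) m * pochhammer b m / (pochhammer c m * fact m) * x ^ m"
    if m: "m \<le> N" for m
  proof -
    have "(fact N :: complex) / fact (N - m) = pochhammer (of_nat N - of_nat m + 1) m"
      using m pochhammer_product'[of "1 :: complex" "N - m" m]
      by (simp add: pochhammer_fact[symmetric] of_nat_diff add.commute)
    then have poch: "pochhammer (- of_nat N :: complex) m = (-1) ^ m * (fact N / fact (N - m))"
      by (simp add: pochhammer_minus)
    have "\<epsilon> ^ N * (\<epsilon> ^ m * \<epsilon> ^ (N - m)) = (\<epsilon> * \<epsilon>) ^ N"
      using m by (simp add: power_add[symmetric] power_mult_distrib)
    then have "\<epsilon> ^ N * (\<epsilon> ^ m * \<epsilon> ^ (N - m)) = 1" using assms by simp
    moreover have "(- \<epsilon> * x) ^ m = (-1) ^ m * \<epsilon> ^ m * x ^ m"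
      by (metis mult_minus1 power_mult_distrib)
    ultimately show ?thesis
      unfolding poch hypergeo_1_1_nth fps_exp_def
      by (simp add: divide_simps)
  qed
  then show ?thesis
    by (simp add: gauss_F_def mult.commute[of "fps_exp \<epsilon>"] fps_mult_nth[of "fps_hypergeo _ _ _"]
          sum_distrib_left atLeast0AtMost del: fps_hypergeo_nth)
qed

lemma B_mat_eq:
  assumes "k \<le> n"
  shows "B_mat x \<nu> n k = (-1) ^ k * (fact n / fact k) * exp_kummer x \<nu> k $ (n - k)"
  using assms gauss_F_eq_coeff[of 1 "n - k" "of_nat k * \<nu>" "of_nat k" x]
  by (simp add: B_mat_def exp_kummer_def binomial_fact del: fps_hypergeo_nth)

lemma A_mat_eq:
  assumes "k \<le> n"
  shows "A_mat x \<nu> n k = (-1) ^ n * (fact n / fact k) * exp_kummer_dual x \<nu> n $ (n - k)"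
proof -
  have "(-1 :: complex) ^ k * (-1) ^ (n - k) = (-1) ^ n"
    using assms by (simp flip: power_add)
  then show ?thesis
    using assms gauss_F_eq_coeff[of "-1" "n - k" "- of_nat n * \<nu>" "- of_nat n" x]
    by (simp add: A_mat_def exp_kummer_dual_def binomial_fact del: fps_hypergeo_nth)
qed

section \<open>Inversion\<close>

text \<open>
  The weight \<open>j\<close> is absorbed by \<open>j (a gchoose j) = a (a - 1 gchoose j - 1)\<close>, which leaves two ordinary
  Vandermonde convolutions.
\<close>

lemma gbinomial_Vandermonde_linear:
  fixes a b c :: "'a :: field_char_0"
  shows "(\<Sum>j=0..Suc p. (c + of_nat j) * (a gchoose j) * (b gchoose (Suc p - j)))
       = c * ((a + b) gchoose Suc p) + a * ((a + b - 1) gchoose p)"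
proof -
  have "(\<Sum>j=0..Suc p. of_nat j * (a gchoose j) * (b gchoose (Suc p - j)))
      = (\<Sum>j=0..p. a * ((a - 1) gchoose j) * (b gchoose (p - j)))"
    by (subst sum.atLeast0_atMost_Suc_shift)
       (simp add: gbinomial_absorption del: of_nat_Suc)
  also have "\<dots> = a * ((a + b - 1) gchoose p)"
    using gbinomial_Vandermonde[of "a - 1" b p]
    by (simp add: sum_distrib_left[symmetric] mult.assoc algebra_simps)
  finally have "(\<Sum>j=0..Suc p. of_nat j * (a gchoose j) * (b gchoose (Suc p - j)))
      = a * ((a + b - 1) gchoose p)" .
  moreover have "(\<Sum>j=0..Suc p. c * (a gchoose j) * (b gchoose (Suc p - j)))
      = c * ((a + b) gchoose Suc p)"
    using gbinomial_Vandermonde[of a b "Suc p"]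
    by (simp only: sum_distrib_left[symmetric] mult.assoc)
  ultimately show ?thesis
    by (simp only: ring_distribs sum.distrib)
qed

text \<open>
  Orthogonality of the columns of one matrix to the rows of the other, with \<open>n = l + p\<close>. After the
  exponentials have cancelled, the degree \<open>j\<close> coefficient of the first factor is
  \<open>(-l\<nu> gchoose j) (l - 1)! / (l + j - 1)!\<close> and the degree \<open>p - j\<close> coefficient of the second is
  \<open>(n\<nu> gchoose (p - j)) (l + j)! / n!\<close>, up to powers of \<open>x\<close>. The factorials depending on \<open>j\<close> collapse
  to the linear factor \<open>l + j\<close>.
\<close>

lemma exp_kummer_dual_mult_nth:
  assumes "0 < l"
  shows "(exp_kummer x \<nu> l * exp_kummer_dual x \<nu> (l + p)) $ p = (if p = 0 then 1 else 0)"
proof -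
  define G where "G = fps_hypergeo [of_nat l * \<nu>] [of_nat l] (- x)"
  define H where "H = fps_hypergeo [- of_nat (l + p) * \<nu>] [- of_nat (l + p)] x"
  have "exp_kummer x \<nu> l * exp_kummer_dual x \<nu> (l + p) = (fps_exp 1 * fps_exp (-1)) * (G * H)"
    by (simp only: exp_kummer_def exp_kummer_dual_def G_def H_def mult_ac)
  also have "fps_exp 1 * fps_exp (-1 :: complex) = 1"
    by (simp flip: fps_exp_add_mult)
  finally have prod: "exp_kummer x \<nu> l * exp_kummer_dual x \<nu> (l + p) = G * H" by simp
  show ?thesis
  proof (cases p)
    case 0
    then show ?thesis unfolding prod by (simp add: G_def H_def)
  next
    case (Suc q)
    define a where "a = - (of_nat l * \<nu>)"
    define b where "b = of_nat (l + p) * \<nu>"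
    have term_eq: "G $ j * H $ (p - j)
        = fact (l - 1) / fact (l + p) * x ^ p
          * ((of_nat l + of_nat j) * (a gchoose j) * (b gchoose (p - j)))"
      if j: "j \<le> p" for j
    proof -
      have "pochhammer (of_nat l :: complex) j = fact (l + j - 1) / fact (l - 1)"
        using assms pochhammer_product'[of "1 :: complex" "l - 1" j]
        by (simp add: pochhammer_fact[symmetric] of_nat_diff)
      moreover have "a gchoose j = (-1) ^ j * pochhammer (of_nat l * \<nu>) j / fact j"
        by (simp add: a_def gbinomial_pochhammer)
      moreover have "(- x) ^ j = (-1) ^ j * x ^ j" by (rule power_minus)
      ultimately have Gj: "G $ j = (a gchoose j) * fact (l - 1) / fact (l + j - 1) * x ^ j"
        unfolding G_def hypergeo_1_1_nth by (simp add: mult_ac)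
      define i where "i = p - j"
      define P where "P = pochhammer (- of_nat (l + p) * \<nu>) i"
      have li: "l + p - i = l + j" "i \<le> l + p" using j by (auto simp: i_def)
      have "b gchoose i = (-1) ^ i * P / fact i"
        by (simp only: b_def P_def gbinomial_pochhammer mult_minus_left)
      moreover have "(-1) ^ i * pochhammer (- of_nat (l + p) :: complex) i
          = fact (l + p) / fact (l + j)"
      proof -
        have "of_nat ((l + p) choose i)
            = (-1) ^ i * pochhammer (- of_nat (l + p) :: complex) i / fact i"
          by (simp only: binomial_gbinomial gbinomial_pochhammer)
        then show ?thesis
          using li by (simp add: binomial_fact field_simps)
      qed
      then have "pochhammer (- of_nat (l + p) :: complex) i
          = (-1) ^ i * (fact (l + p) / fact (l + j))"
        by (metis (no_types, lifting) minus_one_mult_self mult.assoc mult_1)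
      ultimately have Hi: "H $ i = (b gchoose i) * fact (l + j) / fact (l + p) * x ^ i"
        unfolding H_def hypergeo_1_1_nth P_def[symmetric] by (cases "even i") (simp_all add: mult_ac)
      have "(fact (l + j) :: complex) = (of_nat l + of_nat j) * fact (l + j - 1)"
        using assms by (subst fact_reduce) auto
      moreover have "x ^ p = x ^ j * x ^ i" using j by (simp add: i_def flip: power_add)
      ultimately show ?thesis
        unfolding i_def[symmetric] Gj Hi by (simp add: field_simps)
    qed
    have "(G * H) $ p = fact (l - 1) / fact (l + p) * x ^ p
        * (\<Sum>j=0..p. (of_nat l + of_nat j) * (a gchoose j) * (b gchoose (p - j)))"
      unfolding fps_mult_nth sum_distrib_left by (intro sum.cong) (auto simp: term_eq)
    also have "(\<Sum>j=0..p. (of_nat l + of_nat j) * (a gchoose j) * (b gchoose (p - j))) = 0"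
    proof -
      \<comment> \<open>Both parts of the linear Vandermonde sum are multiples of \<open>(p\<nu> - 1) gchoose (p - 1)\<close>.\<close>
      have ab: "a + b = of_nat p * \<nu>" by (simp add: a_def b_def algebra_simps)
      have "of_nat p * ((a + b) gchoose Suc q) = (a + b) * ((a + b - 1) gchoose q)"
        using gbinomial_absorption[of q "a + b"] Suc by simp
      then have "of_nat p * ((a + b) gchoose Suc q)
          = of_nat p * (\<nu> * ((a + b - 1) gchoose q))"
        by (simp only: ab mult.assoc)
      then have "(a + b) gchoose Suc q = \<nu> * ((a + b - 1) gchoose q)"
        unfolding Suc by (simp only: mult_cancel_left of_nat_eq_0_iff) simp
      then show ?thesis
        unfolding Suc gbinomial_Vandermonde_linear by (simp add: a_def)
    qed
    finally show ?thesis unfolding prod using Suc by simp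
  qed
qed

lemma exp_kummer_dual_0: "exp_kummer_dual x \<nu> n $ 0 = 1"
  by (simp add: exp_kummer_dual_def)

text \<open>
  The actions of \<open>B\<close> and \<open>A\<close> on the normalized sequences \<open>t\<close> and \<open>s\<close>. Position \<open>j\<close> holds the entry with
  index \<open>j + 1\<close>, in step with the numbering of the terms of the numerical series.
\<close>

definition kummer_transform :: "complex \<Rightarrow> complex \<Rightarrow> (nat \<Rightarrow> complex) \<Rightarrow> nat \<Rightarrow> complex" where
  "kummer_transform x \<nu> t n = (\<Sum>k\<le>n. t k * exp_kummer x \<nu> (Suc k) $ (n - k))"

definition dual_transform :: "complex \<Rightarrow> complex \<Rightarrow> (nat \<Rightarrow> complex) \<Rightarrow> nat \<Rightarrow> complex" where
  "dual_transform x \<nu> s n = (\<Sum>k\<le>n. s k * exp_kummer_dual x \<nu> (Suc n) $ (n - k))"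

lemma dual_transform_kummer_transform:
  "dual_transform x \<nu> (kummer_transform x \<nu> t) = t"
proof
  fix n
  have "dual_transform x \<nu> (kummer_transform x \<nu> t) n
      = (\<Sum>k\<le>n. \<Sum>l\<le>k. t l * (exp_kummer x \<nu> (Suc l) $ (k - l)
           * exp_kummer_dual x \<nu> (Suc n) $ (n - k)))"
    by (simp add: dual_transform_def kummer_transform_def sum_distrib_right mult.assoc)
  also have "\<dots> = (\<Sum>l\<le>n. \<Sum>k=l..n. t l * (exp_kummer x \<nu> (Suc l) $ (k - l)
           * exp_kummer_dual x \<nu> (Suc n) $ (n - k)))"
    by (simp add: sum.Sigma)
       (rule sum.reindex_bij_witness[of _ "\<lambda>(l, k). (k, l)" "\<lambda>(k, l). (l, k)"]; auto)
  also have "\<dots> = (\<Sum>l\<le>n. if l = n then t l else 0)"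
  proof (intro sum.cong refl)
    fix l assume "l \<in> {..n}"
    then obtain p where p: "n = l + p" by (auto simp: le_iff_add)
    have "(\<Sum>k=l..n. exp_kummer x \<nu> (Suc l) $ (k - l) * exp_kummer_dual x \<nu> (Suc n) $ (n - k))
        = (exp_kummer x \<nu> (Suc l) * exp_kummer_dual x \<nu> (Suc l + p)) $ p"
      unfolding fps_mult_nth p
      by (rule sum.reindex_bij_witness[of _ "\<lambda>i. l + i" "\<lambda>k. k - l"]) (auto simp: add.commute)
    then show "(\<Sum>k=l..n. t l * (exp_kummer x \<nu> (Suc l) $ (k - l)
           * exp_kummer_dual x \<nu> (Suc n) $ (n - k))) = (if l = n then t l else 0)"
      using exp_kummer_dual_mult_nth[of "Suc l" x \<nu> p] p
      by (simp flip: sum_distrib_left)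
  qed
  finally show "dual_transform x \<nu> (kummer_transform x \<nu> t) n = t n" by simp
qed

text \<open>
  A triangular system with unit diagonal determines its unknowns one after the other.
\<close>

lemma dual_transform_inject:
  assumes "dual_transform x \<nu> s = dual_transform x \<nu> s'"
  shows "s = s'"
proof
  fix n
  show "s n = s' n"
  proof (induction n rule: less_induct)
    case (less n)
    have "dual_transform x \<nu> u n
        = (\<Sum>k<n. u k * exp_kummer_dual x \<nu> (Suc n) $ (n - k)) + u n" for u
      by (simp add: dual_transform_def exp_kummer_dual_0 flip: lessThan_Suc_atMost)
    then show ?case
      using fun_cong[OF assms, of n] less.IH by simp
  qed
qed

text \<open>
  A right inverse of an injective map is also a left inverse.
\<close>

lemma kummer_transform_dual_transform:
  "kummer_transform x \<nu> (dual_transform x \<nu> s) = s"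
  by (rule dual_transform_inject) (rule dual_transform_kummer_transform)

section \<open>Coefficient bounds uniform in the index\<close>

text \<open>
  The confluent series is dominated termwise by \<open>exp (K \<bar>y\<bar> z)\<close>, hence the product by
  \<open>exp ((\<bar>a\<bar> + K \<bar>y\<bar>) z)\<close>.
\<close>

lemma norm_exp_hypergeo_coeff_le:
  fixes a b c y :: complex
  assumes "\<And>j. norm (pochhammer b j / pochhammer c j) \<le> K ^ j"
  shows "norm ((fps_exp a * fps_hypergeo [b] [c] y) $ m) \<le> (norm a + K * norm y) ^ m / fact m"
proof -
  have "norm ((fps_exp a * fps_hypergeo [b] [c] y) $ m)
      \<le> (\<Sum>i=0..m. norm (fps_exp a $ i * fps_hypergeo [b] [c] y $ (m - i)))"
    unfolding fps_mult_nth by (rule norm_sum)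
  also have "\<dots> \<le> (\<Sum>i=0..m. norm a ^ i / fact i * ((K * norm y) ^ (m - i) / fact (m - i)))"
  proof (intro sum_mono)
    fix i
    have "norm (fps_hypergeo [b] [c] y $ (m - i))
        = norm (pochhammer b (m - i) / pochhammer c (m - i)) * norm y ^ (m - i) / fact (m - i)"
      unfolding hypergeo_1_1_nth by (simp add: norm_mult norm_divide norm_power)
    also have "\<dots> \<le> K ^ (m - i) * norm y ^ (m - i) / fact (m - i)"
      by (intro divide_right_mono mult_right_mono assms) auto
    finally have "norm (fps_hypergeo [b] [c] y $ (m - i)) \<le> (K * norm y) ^ (m - i) / fact (m - i)"
      by (simp only: power_mult_distrib)
    then show "norm (fps_exp a $ i * fps_hypergeo [b] [c] y $ (m - i))
        \<le> norm a ^ i / fact i * ((K * norm y) ^ (m - i) / fact (m - i))"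
      unfolding norm_mult
      by (intro mult_mono) (auto simp: norm_divide norm_power simp del: fps_hypergeo_nth)
  qed
  also have "\<dots> = (\<Sum>i\<le>m. of_nat (m choose i) * norm a ^ i * (K * norm y) ^ (m - i)) / fact m"
    by (simp add: sum_divide_distrib atLeast0AtMost binomial_fact)
  also have "\<dots> = (norm a + K * norm y) ^ m / fact m"
    by (simp add: binomial_ring)
  finally show ?thesis .
qed

lemma norm_pochhammer_ratio_le:
  assumes "0 < k"
  shows "norm (pochhammer (of_nat k * \<nu>) j / pochhammer (of_nat k) j :: complex) \<le> (1 + norm \<nu>) ^ j"
proof (induction j)
  case (Suc j)
  have "norm (of_nat k * \<nu> + of_nat j) \<le> real k * norm \<nu> + real j"
    by (metis norm_mult norm_of_nat norm_triangle_ineq)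
  also have "\<dots> \<le> (1 + norm \<nu>) * (real k + real j)"
    by (simp add: algebra_simps)
  finally have "norm (of_nat k * \<nu> + of_nat j) / (real k + real j) \<le> 1 + norm \<nu>"
    using assms by (simp add: divide_le_eq)
  moreover have "norm (of_nat k + of_nat j :: complex) = real k + real j"
    by (metis norm_of_nat of_nat_add)
  ultimately have "norm ((of_nat k * \<nu> + of_nat j) / (of_nat k + of_nat j)) \<le> 1 + norm \<nu>"
    by (simp add: norm_divide)
  with Suc.IH have "norm (pochhammer (of_nat k * \<nu>) j / pochhammer (of_nat k) j)
      * norm ((of_nat k * \<nu> + of_nat j) / (of_nat k + of_nat j)) \<le> (1 + norm \<nu>) ^ j * (1 + norm \<nu>)"
    by (intro mult_mono) auto
  then show ?case
    by (simp add: pochhammer_Suc norm_mult norm_divide mult.commute)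
qed simp

text \<open>
  The falling factorial \<open>n (n - 1) \<cdots> (n - j + 1)\<close> is at least \<open>(n / e)\<^sup>j\<close>, uniformly in \<open>j \<le> n = m + j\<close>.
  The induction keeps \<open>m\<close> fixed; each step costs a factor \<open>(1 + 1 / n)\<^sup>j \<le> exp (j / n) \<le> e\<close>.
\<close>

lemma power_mult_fact_le:
  "real (m + j) ^ j * fact m \<le> exp 1 ^ j * fact (m + j)"
proof (induction j)
  case (Suc j)
  define N where "N = real (m + j)"
  have *: "(N + 1) ^ j \<le> exp 1 * N ^ j"
  proof (cases "j = 0")
    case False
    then have N: "N > 0" "real j \<le> N" by (auto simp: N_def)
    have "(1 + 1 / N) ^ j \<le> exp (1 / N) ^ j"
      by (intro power_mono) (use N in auto)
    also have "\<dots> = exp (real j / N)"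
      by (simp flip: exp_of_nat_mult)
    also have "\<dots> \<le> exp 1" using N by simp
    finally have "(1 + 1 / N) ^ j * N ^ j \<le> exp 1 * N ^ j"
      using N by (intro mult_right_mono) auto
    moreover have "(1 + 1 / N) * N = N + 1" using N by (simp add: field_simps)
    ultimately show ?thesis by (simp flip: power_mult_distrib)
  qed simp
  have "real (m + Suc j) ^ Suc j * fact m = (N + 1) * ((N + 1) ^ j * fact m)"
    by (simp add: N_def algebra_simps)
  also have "\<dots> \<le> (N + 1) * (exp 1 * N ^ j * fact m)"
    using * by (intro mult_left_mono mult_right_mono) (auto simp: N_def)
  also have "\<dots> = (N + 1) * exp 1 * (N ^ j * fact m)" by simp
  also have "\<dots> \<le> (N + 1) * exp 1 * (exp 1 ^ j * fact (m + j))"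
    using Suc.IH by (intro mult_left_mono) (auto simp: N_def)
  also have "\<dots> = exp 1 ^ Suc j * fact (m + Suc j)"
    by (simp add: N_def algebra_simps)
  finally show ?case .
qed simp

text \<open>
  The single factors \<open>\<bar>n\<nu> - i\<bar> / (n - i)\<close> are not bounded uniformly in \<open>n\<close>, since the denominators come
  down to \<open>1\<close>. Only their product is, by the lower bound on falling factorials.
\<close>

lemma norm_pochhammer_neg_ratio_le:
  "norm (pochhammer (- of_nat n * \<nu>) j / pochhammer (- of_nat n) j :: complex)
     \<le> (exp 1 * (1 + norm \<nu>)) ^ j"
proof (cases "j \<le> n")
  case True
  then obtain m where m: "n = m + j" by (metis le_add_diff_inverse2)
  have "norm (pochhammer (- of_nat n * \<nu>) j) \<le> (\<Prod>i=0..<j. real n * (1 + norm \<nu>))"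
    unfolding pochhammer_prod prod_norm[symmetric]
  proof (intro prod_mono conjI norm_ge_zero)
    fix i assume "i \<in> {0..<j}"
    then have "real i \<le> real n" using True by simp
    have "norm (- of_nat n * \<nu> + of_nat i) \<le> real n * norm \<nu> + real i"
      using norm_triangle_ineq[of "- of_nat n * \<nu>" "of_nat i"] by (simp add: norm_mult)
    also have "\<dots> \<le> real n * (1 + norm \<nu>)"
      using \<open>real i \<le> real n\<close> by (simp add: algebra_simps)
    finally show "norm (- of_nat n * \<nu> + of_nat i) \<le> real n * (1 + norm \<nu>)" .
  qed
  then have num: "norm (pochhammer (- of_nat n * \<nu>) j) \<le> real n ^ j * (1 + norm \<nu>) ^ j"
    by (simp add: power_mult_distrib)
  have "(of_nat (n choose j) :: complex) = (-1) ^ j * pochhammer (- of_nat n) j / fact j"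
    by (simp only: binomial_gbinomial gbinomial_pochhammer)
  then have "norm (of_nat (n choose j) :: complex) = norm (pochhammer (- of_nat n :: complex) j) / fact j"
    by (simp add: norm_mult norm_divide norm_power)
  then have "norm (pochhammer (- of_nat n :: complex) j) = real (n choose j) * fact j"
    by simp
  then have den: "norm (pochhammer (- of_nat n :: complex) j) = fact n / fact m"
    using True by (simp add: binomial_fact m)
  have "real n ^ j * (1 + norm \<nu>) ^ j * fact m \<le> exp 1 ^ j * fact n * (1 + norm \<nu>) ^ j"
    using mult_right_mono[OF power_mult_fact_le[of m j], of "(1 + norm \<nu>) ^ j"] m
    by (simp add: mult_ac)
  then have "real n ^ j * (1 + norm \<nu>) ^ j / (fact n / fact m) \<le> (exp 1 * (1 + norm \<nu>)) ^ j"
    unfolding power_mult_distrib by (simp add: divide_le_eq le_divide_eq mult_ac)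
  moreover have "norm (pochhammer (- of_nat n * \<nu>) j) / (fact n / fact m)
      \<le> real n ^ j * (1 + norm \<nu>) ^ j / (fact n / fact m)"
    using num by (intro divide_right_mono) auto
  ultimately show ?thesis
    by (simp only: norm_divide den)
next
  case False
  then show ?thesis by (simp add: pochhammer_of_nat_eq_0_lemma)
qed

lemma norm_exp_kummer_le:
  assumes "0 < k"
  shows "norm (exp_kummer x \<nu> k $ m * z ^ m) \<le> ((1 + (1 + norm \<nu>) * norm x) * norm z) ^ m / fact m"
proof -
  have "norm (exp_kummer x \<nu> k $ m) \<le> (1 + (1 + norm \<nu>) * norm x) ^ m / fact m"
    using norm_exp_hypergeo_coeff_le[OF norm_pochhammer_ratio_le[OF assms], of 1 \<nu> "- x" m]
    by (simp only: exp_kummer_def norm_minus_cancel norm_one)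
  from mult_right_mono[OF this, of "norm z ^ m"] show ?thesis
    by (simp add: norm_mult norm_power power_mult_distrib)
qed

lemma norm_exp_kummer_dual_le:
  "norm (exp_kummer_dual x \<nu> n $ m * z ^ m)
     \<le> ((1 + exp 1 * (1 + norm \<nu>) * norm x) * norm z) ^ m / fact m"
proof -
  have "norm (exp_kummer_dual x \<nu> n $ m) \<le> (1 + exp 1 * (1 + norm \<nu>) * norm x) ^ m / fact m"
    using norm_exp_hypergeo_coeff_le[OF norm_pochhammer_neg_ratio_le, of "-1" n \<nu> x m]
    by (simp only: exp_kummer_dual_def norm_minus_cancel norm_one)
  from mult_right_mono[OF this, of "norm z ^ m"] show ?thesis
    by (simp add: norm_mult norm_power power_mult_distrib)
qed

section \<open>Comparison of partial sums\<close>

text \<open>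
  Indexed by \<open>m = N - i\<close>, the sum is dominated termwise by a multiple of \<open>\<rho> m\<close>, and for fixed \<open>m\<close> its term
  tends to \<open>0\<close> with \<open>N\<close>; Tannery's theorem exchanges limit and sum.
\<close>

lemma convolution_tendsto_0:
  fixes a :: "nat \<Rightarrow> 'a :: {real_normed_field, banach}" and r :: "nat \<Rightarrow> nat \<Rightarrow> 'a"
  assumes a: "a \<longlonglongrightarrow> 0" and r: "\<And>i m. norm (r i m) \<le> \<rho> m" and \<rho>: "summable \<rho>"
  shows "(\<lambda>N. \<Sum>i\<le>N. a i * r i (N - i)) \<longlonglongrightarrow> 0"
proof -
  obtain C where C: "\<And>i. norm (a i) \<le> C"
    using convergent_imp_Bseq[OF convergentI[OF a]] by (meson BseqE)
  have \<rho>0: "\<rho> m \<ge> 0" for m using order_trans[OF norm_ge_zero r[of 0 m]] .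
  define f where "f m N = (if m \<le> N then a (N - m) * r (N - m) m else 0)" for m N
  have bound: "norm (f m N) \<le> C * \<rho> m" for m N
  proof (cases "m \<le> N")
    case True
    then show ?thesis
      unfolding f_def by (simp add: norm_mult)
        (intro mult_mono C r order_trans[OF norm_ge_zero C]; simp)
  next
    case False
    then show ?thesis
      using \<rho>0[of m] order_trans[OF norm_ge_zero C[of 0]] by (simp add: f_def)
  qed
  have "(\<lambda>N. \<Sum>m. f m N) \<longlonglongrightarrow> (\<Sum>m. 0)"
  proof (intro conjunct2[OF conjunct2[OF tannerys_theorem]])
    show "summable (\<lambda>m. C * \<rho> m)" using \<rho> by (rule summable_mult)
    show "\<forall>\<^sub>F (m, N) in sequentially \<times>\<^sub>F sequentially. norm (f m N) \<le> C * \<rho> m"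
      using bound by (auto simp: eventually_prod_sequentially)
    fix m
    have "(\<lambda>N. a (N - m)) \<longlonglongrightarrow> 0"
      by (rule LIMSEQ_offset[where k = m]) (simp add: a)
    then have "(\<lambda>N. norm (a (N - m)) * \<rho> m) \<longlonglongrightarrow> 0"
      by (intro tendsto_mult_left_zero tendsto_norm_zero)
    then show "f m \<longlonglongrightarrow> 0"
    proof (rule Lim_null_comparison[rotated])
      show "\<forall>\<^sub>F N in sequentially. norm (f m N) \<le> norm (a (N - m)) * \<rho> m"
        using r \<rho>0 by (auto simp: f_def norm_mult intro!: always_eventually mult_left_mono)
    qed
  qed simp
  moreover have "(\<Sum>m. f m N) = (\<Sum>i\<le>N. a i * r i (N - i))" for N
  proof -
    have "(\<Sum>m. f m N) = (\<Sum>m\<le>N. f m N)"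
      by (rule suminf_finite) (auto simp: f_def)
    also have "\<dots> = (\<Sum>i\<le>N. a i * r i (N - i))"
      by (rule sum.reindex_bij_witness[of _ "\<lambda>i. N - i" "\<lambda>i. N - i"]) (auto simp: f_def)
    finally show ?thesis .
  qed
  ultimately show ?thesis by simp
qed

lemma summable_power_div_fact: "summable (\<lambda>m. L ^ m / fact m :: real)"
  using summable_exp[of L] by (simp add: field_simps)

lemma suminf_power_div_fact: "(\<Sum>m. L ^ m / fact m) = exp (L :: real)"
  using exp_converges[of L] by (simp add: sums_iff field_simps)

text \<open>
  Because \<open>(m + M + 1)! \<ge> m! M!\<close>, the tail of an exponentially dominated series is again summable as a
  function of the truncation point \<open>M\<close>.
\<close>

lemma norm_suminf_tail_le:
  fixes w :: "nat \<Rightarrow> 'a :: banach"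
  assumes w: "\<And>m. norm (w m) \<le> L ^ m / fact m" and "0 \<le> L"
  shows "norm (suminf w - (\<Sum>m\<le>M. w m)) \<le> L ^ M / fact M * (L * exp L)"
proof -
  have sw: "summable w"
    by (rule summable_comparison_test'[OF summable_power_div_fact w])
  have bound: "norm (w (m + Suc M)) \<le> L ^ M / fact M * L * (L ^ m / fact m)" for m
  proof -
    have "fact m * fact M \<le> (fact (m + Suc M) :: real)"
    proof -
      have "fact m * fact M \<le> (fact (m + M) :: nat)"
        by (rule dvd_imp_le[OF fact_fact_dvd_fact]) simp
      also have "\<dots> \<le> fact (m + Suc M)" by (rule fact_mono) simp
      finally have "real (fact m * fact M) \<le> real (fact (m + Suc M))"
        by (simp only: of_nat_le_iff)
      then show ?thesis by (simp only: of_nat_mult of_nat_fact)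
    qed
    then have "L ^ (m + Suc M) / fact (m + Suc M) \<le> L ^ (m + Suc M) / (fact m * fact M)"
      using \<open>0 \<le> L\<close> by (intro divide_left_mono) auto
    also have "\<dots> = L ^ M / fact M * L * (L ^ m / fact m)"
      by (simp add: power_add mult_ac)
    finally show ?thesis using w[of "m + Suc M"] by linarith
  qed
  have sb: "summable (\<lambda>m. L ^ M / fact M * L * (L ^ m / fact m))"
    by (intro summable_mult summable_power_div_fact)
  have "suminf w - (\<Sum>m\<le>M. w m) = (\<Sum>m. w (m + Suc M))"
    using suminf_split_initial_segment[OF sw, of "Suc M"] by (simp add: lessThan_Suc_atMost)
  also have "norm \<dots> \<le> (\<Sum>m. L ^ M / fact M * L * (L ^ m / fact m))"
    by (rule norm_suminf_le[OF bound sb])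
  also have "\<dots> = L ^ M / fact M * (L * exp L)"
    using suminf_mult[OF summable_power_div_fact, of "L ^ M / fact M * L" L] suminf_power_div_fact[of L]
    by (simp only: mult.assoc)
  finally show ?thesis .
qed

lemma sum_convolution:
  fixes a :: "nat \<Rightarrow> 'a :: comm_ring"
  shows "(\<Sum>j\<le>N. \<Sum>i\<le>j. a i * w i (j - i)) = (\<Sum>i\<le>N. a i * (\<Sum>m\<le>N - i. w i m))"
proof (induction N)
  case (Suc N)
  have "(\<Sum>i\<le>N. a i * (\<Sum>m\<le>Suc N - i. w i m))
      = (\<Sum>i\<le>N. a i * (\<Sum>m\<le>N - i. w i m) + a i * w i (Suc N - i))"
    by (intro sum.cong refl) (simp add: Suc_diff_le algebra_simps)
  with Suc show ?case by (simp add: sum.distrib)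
qed simp

text \<open>
  Regrouped by \<open>i\<close>, the \<open>N\<close>-th partial sum of the convolution contains \<open>w i\<close> truncated at \<open>N - i\<close>. The
  difference to the complete sums is therefore a convolution of \<open>a\<close> with the summable tails.
\<close>

lemma convolution_partial_sums:
  fixes a :: "nat \<Rightarrow> 'a :: {real_normed_field, banach}" and w :: "nat \<Rightarrow> nat \<Rightarrow> 'a"
  assumes a: "a \<longlonglongrightarrow> 0" and w: "\<And>i m. norm (w i m) \<le> L ^ m / fact m" and "0 \<le> L"
  shows "(\<lambda>N. (\<Sum>j\<le>N. \<Sum>i\<le>j. a i * w i (j - i)) - (\<Sum>i\<le>N. a i * suminf (w i))) \<longlonglongrightarrow> 0"
proof -
  have "(\<lambda>N. \<Sum>i\<le>N. a i * (suminf (w i) - (\<Sum>m\<le>N - i. w i m))) \<longlonglongrightarrow> 0"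
    by (rule convolution_tendsto_0[OF a norm_suminf_tail_le[OF w \<open>0 \<le> L\<close>]])
       (intro summable_mult2 summable_power_div_fact)
  from tendsto_minus[OF this] show ?thesis
    by (simp add: sum_convolution sum_subtractf algebra_simps)
qed

lemma exp_kummer_sums:
  assumes "0 < k"
  shows "(\<lambda>m. exp_kummer x \<nu> k $ m * z ^ m) sums (exp z * conf_hyp (of_nat k * \<nu>) (of_nat k) (- x * z))"
proof -
  define e where "e m = z ^ m / fact m" for m
  define g where "g m = pochhammer (of_nat k * \<nu>) m / pochhammer (of_nat k) m * ((- x * z) ^ m / fact m)" for m
  have "summable (\<lambda>m. norm (e m))"
    using summable_power_div_fact[of "norm z"] by (simp add: e_def norm_divide norm_power)
  moreover have "summable (\<lambda>m. norm (g m))"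
  proof (rule summable_comparison_test'[OF summable_power_div_fact])
    fix m
    show "norm (norm (g m)) \<le> ((1 + norm \<nu>) * norm (- x * z)) ^ m / fact m"
      using mult_right_mono[OF norm_pochhammer_ratio_le[OF assms, of \<nu> m], of "norm ((- x * z) ^ m / fact m)"]
      unfolding g_def norm_mult norm_divide norm_power
      by (simp add: power_mult_distrib norm_mult norm_divide norm_power)
  qed
  ultimately have "(\<lambda>m. \<Sum>i\<le>m. e i * g (m - i)) sums (suminf e * suminf g)"
    by (rule Cauchy_product_sums)
  moreover have "suminf e = exp z"
    using exp_converges[of z] by (simp add: e_def[abs_def] sums_iff scaleR_conv_of_real field_simps)
  moreover have "suminf g = conf_hyp (of_nat k * \<nu>) (of_nat k) (- x * z)"
    by (simp add: g_def[abs_def] conf_hyp_def)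
  moreover have "(\<Sum>i\<le>m. e i * g (m - i)) = exp_kummer x \<nu> k $ m * z ^ m" for m
    unfolding exp_kummer_def fps_mult_nth sum_distrib_right atLeast0AtMost
  proof (intro sum.cong refl)
    fix i assume "i \<in> {..m}"
    then have "z ^ m = z ^ i * z ^ (m - i)" by (simp flip: power_add)
    then show "e i * g (m - i) = fps_exp 1 $ i * fps_hypergeo [of_nat k * \<nu>] [of_nat k] (- x) $ (m - i) * z ^ m"
      by (simp only: e_def g_def hypergeo_1_1_nth power_mult_distrib) simp
  qed
  ultimately show ?thesis by simp
qed

text \<open>
  For fixed \<open>m\<close> one has \<open>(k\<nu>)\<^sub>m / (k)\<^sub>m \<rightarrow> \<nu>\<^sup>m\<close>, and the ratios are bounded by \<open>(1 + \<bar>\<nu>\<bar>)\<^sup>m\<close>, so the limit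
  may be taken inside the series. That the limit does not vanish is what matters later.
\<close>

lemma conf_hyp_tendsto_exp:
  "(\<lambda>k. conf_hyp (of_nat k * \<nu>) (of_nat k) Z) \<longlonglongrightarrow> exp (\<nu> * Z)"
proof -
  define f where "f m k = pochhammer (of_nat k * \<nu>) m / pochhammer (of_nat k) m * (Z ^ m / fact m)" for m k
  have "(\<lambda>k. \<Sum>m. f m k) \<longlonglongrightarrow> (\<Sum>m. \<nu> ^ m * (Z ^ m / fact m))"
  proof (intro conjunct2[OF conjunct2[OF tannerys_theorem]])
    show "summable (\<lambda>m. ((1 + norm \<nu>) * norm Z) ^ m / fact m)"
      by (rule summable_power_div_fact)
    have "norm (f m k) \<le> ((1 + norm \<nu>) * norm Z) ^ m / fact m" if "0 < k" for m k
      using mult_right_mono[OF norm_pochhammer_ratio_le[OF that, of \<nu> m], of "norm (Z ^ m / fact m)"]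
      unfolding f_def norm_mult
      by (simp add: power_mult_distrib norm_mult norm_divide norm_power)
    then show "\<forall>\<^sub>F (m, k) in sequentially \<times>\<^sub>F sequentially. norm (f m k) \<le> ((1 + norm \<nu>) * norm Z) ^ m / fact m"
      unfolding eventually_prod_sequentially by (auto intro!: exI[of _ 1])
    fix m
    have ratio: "(\<lambda>k. (of_nat k * \<nu> + of_nat i) / (of_nat k + of_nat i)) \<longlonglongrightarrow> \<nu>" for i
    proof -
      have "filterlim (\<lambda>k. of_nat (k + i) :: complex) at_infinity sequentially"
        by (intro filterlim_compose[OF tendsto_of_nat] filterlim_add_const_nat_at_top)
      then have "(\<lambda>k. \<nu> + of_nat i * (1 - \<nu>) / of_nat (k + i)) \<longlonglongrightarrow> \<nu> + 0"
        by (intro tendsto_add tendsto_const tendsto_divide_0[OF tendsto_const])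
      moreover have "\<forall>\<^sub>F k in sequentially. \<nu> + of_nat i * (1 - \<nu>) / of_nat (k + i)
          = (of_nat k * \<nu> + of_nat i) / (of_nat k + of_nat i)"
      proof (rule eventually_sequentiallyI[of 1])
        fix k :: nat assume "1 \<le> k"
        then have "(of_nat k + of_nat i :: complex) \<noteq> 0"
          by (metis add_is_0 not_one_le_zero of_nat_add of_nat_eq_0_iff)
        then show "\<nu> + of_nat i * (1 - \<nu>) / of_nat (k + i)
          = (of_nat k * \<nu> + of_nat i) / (of_nat k + of_nat i)"
          by (simp add: field_simps)
      qed
      ultimately show ?thesis by (simp add: tendsto_cong)
    qed
    have "(\<lambda>k. pochhammer (of_nat k * \<nu>) m / pochhammer (of_nat k) m) \<longlonglongrightarrow> \<nu> ^ m"
    proof (induction m)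
      case (Suc m)
      show ?case
        using tendsto_mult[OF Suc ratio[of m]] by (simp add: pochhammer_Suc mult.commute)
    qed simp
    then show "f m \<longlonglongrightarrow> \<nu> ^ m * (Z ^ m / fact m)"
      unfolding f_def by (intro tendsto_mult_right)
  qed simp
  moreover have "(\<Sum>m. \<nu> ^ m * (Z ^ m / fact m)) = exp (\<nu> * Z)"
    using exp_converges[of "\<nu> * Z"]
    by (simp add: sums_iff scaleR_conv_of_real field_simps)
  ultimately show ?thesis
    by (simp add: f_def conf_hyp_def)
qed

section \<open>The identity of formal power series\<close>

lemma fps_sums_triangular:
  fixes f :: "nat \<Rightarrow> 'a :: comm_ring_1 fps"
  assumes "\<And>j n. n \<le> j \<Longrightarrow> f j $ n = 0"
  shows "f sums Abs_fps (\<lambda>n. \<Sum>j<n. f j $ n)"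
  unfolding sums_def
proof (rule tendsto_fpsI)
  fix n
  show "\<forall>\<^sub>F N in sequentially. (\<Sum>j<N. f j) $ n = Abs_fps (\<lambda>n. \<Sum>j<n. f j $ n) $ n"
  proof (rule eventually_sequentiallyI)
    fix N assume "n \<le> N"
    then show "(\<Sum>j<N. f j) $ n = Abs_fps (\<lambda>n. \<Sum>j<n. f j $ n) $ n"
      unfolding fps_sum_nth fps_nth_Abs_fps
      by (intro sum.mono_neutral_right) (auto intro: assms leI)
  qed
qed

lemma fps_kummer_sums:
  fixes x \<nu> :: complex and T :: "nat \<Rightarrow> complex"
  defines "t \<equiv> \<lambda>j. (-1) ^ Suc j * T (Suc j) / fact (Suc j)"
  shows "summable (fps_kummer_term x \<nu> T)"
    and "fps_exp 1 * (\<Sum>j. fps_kummer_term x \<nu> T j)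
       = Abs_fps (\<lambda>n. if n = 0 then 0 else kummer_transform x \<nu> t (n - 1))"
proof -
  define h where "h j = fps_kummer_term x \<nu> T j" for j
  have h: "h j = fps_X ^ Suc j * (fps_const (t j) * fps_hypergeo [of_nat (Suc j) * \<nu>] [of_nat (Suc j)] (- x))" for j
    by (simp only: h_def fps_kummer_term_def Let_def t_def mult_ac)
  have h0: "h j $ n = 0" if "n \<le> j" for j n
    using that unfolding h fps_X_power_mult_nth by simp
  have sums: "h sums Abs_fps (\<lambda>n. \<Sum>j<n. h j $ n)"
    using h0 by (rule fps_sums_triangular)
  then show "summable (fps_kummer_term x \<nu> T)"
    by (simp add: sums_iff h_def[abs_def])
  have eh: "(fps_exp 1 * h j) $ n = (if j < n then t j * exp_kummer x \<nu> (Suc j) $ (n - Suc j) else 0)" for j n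
  proof -
    have "fps_exp 1 * h j = fps_X ^ Suc j * (fps_const (t j) * exp_kummer x \<nu> (Suc j))"
      by (simp only: h exp_kummer_def mult_ac)
    then show ?thesis by (simp only: fps_X_power_mult_nth fps_mult_left_const_nth) auto
  qed
  have "fps_exp 1 * (\<Sum>j. h j) = Abs_fps (\<lambda>n. if n = 0 then 0 else kummer_transform x \<nu> t (n - 1))"
  proof (rule fps_ext)
    fix n
    \<comment> \<open>In degree \<open>n\<close> only the terms with \<open>j < n\<close> count, so the sum over \<open>j\<close> gets a bound that does not
      depend on \<open>i\<close>, and multiplication by the exponential can be done term by term.\<close>
    have "(fps_exp 1 * (\<Sum>j. h j)) $ n = (\<Sum>i=0..n. fps_exp 1 $ i * (\<Sum>j<n - i. h j $ (n - i)))"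
      using sums by (simp add: sums_iff fps_mult_nth)
    also have "\<dots> = (\<Sum>i=0..n. fps_exp 1 $ i * (\<Sum>j<n. h j $ (n - i)))"
      using h0 by (intro sum.cong refl arg_cong2[where f = "(*)"] sum.mono_neutral_left) auto
    also have "\<dots> = (\<Sum>j<n. (fps_exp 1 * h j) $ n)"
      unfolding fps_mult_nth sum_distrib_left by (rule sum.swap)
    also have "\<dots> = (\<Sum>j<n. t j * exp_kummer x \<nu> (Suc j) $ (n - Suc j))"
      by (simp add: eh)
    also have "\<dots> = (if n = 0 then 0 else kummer_transform x \<nu> t (n - 1))"
      by (cases n) (auto simp: kummer_transform_def lessThan_Suc_atMost)
    finally show "(fps_exp 1 * (\<Sum>j. h j)) $ n
        = Abs_fps (\<lambda>n. if n = 0 then 0 else kummer_transform x \<nu> t (n - 1)) $ n" by simp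
  qed
  then show "fps_exp 1 * (\<Sum>j. fps_kummer_term x \<nu> T j)
       = Abs_fps (\<lambda>n. if n = 0 then 0 else kummer_transform x \<nu> t (n - 1))"
    by (simp add: h_def[abs_def])
qed

section \<open>The identity of numerical series\<close>

lemma power_times_transform:
  "kummer_transform x \<nu> t n * z ^ Suc n
     = (\<Sum>k\<le>n. (t k * z ^ Suc k) * (exp_kummer x \<nu> (Suc k) $ (n - k) * z ^ (n - k)))"
  "dual_transform x \<nu> t n * z ^ Suc n
     = (\<Sum>k\<le>n. (t k * z ^ Suc k) * (exp_kummer_dual x \<nu> (Suc n) $ (n - k) * z ^ (n - k)))"
proof -
  have "z ^ Suc n = z ^ Suc k * z ^ (n - k)" if "k \<in> {..n}" for k
    using that by (simp flip: power_add)
  then show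
    "kummer_transform x \<nu> t n * z ^ Suc n
       = (\<Sum>k\<le>n. (t k * z ^ Suc k) * (exp_kummer x \<nu> (Suc k) $ (n - k) * z ^ (n - k)))"
    "dual_transform x \<nu> t n * z ^ Suc n
       = (\<Sum>k\<le>n. (t k * z ^ Suc k) * (exp_kummer_dual x \<nu> (Suc n) $ (n - k) * z ^ (n - k)))"
    unfolding kummer_transform_def dual_transform_def sum_distrib_right
    by (auto intro!: sum.cong simp del: power_Suc)
qed

text \<open>
  Convergence of either series makes \<open>t\<^sub>j z\<^sup>j\<close> a null sequence, and this is all that is needed for the
  two sequences of partial sums to have the same limit behaviour.
\<close>

lemma kummer_transform_summable_iff:
  fixes t :: "nat \<Rightarrow> complex" and x \<nu> z :: complex
  defines "e \<equiv> \<lambda>j. kummer_transform x \<nu> t j * z ^ Suc j"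
    and "\<kappa> \<equiv> \<lambda>j. t j * z ^ Suc j * conf_hyp (of_nat (Suc j) * \<nu>) (of_nat (Suc j)) (- x * z)"
  shows "summable e \<longleftrightarrow> summable \<kappa>" and "summable e \<Longrightarrow> suminf e = exp z * suminf \<kappa>"
proof -
  define a where "a j = t j * z ^ Suc j" for j
  define \<Phi> where "\<Phi> j = conf_hyp (of_nat (Suc j) * \<nu>) (of_nat (Suc j)) (- x * z)" for j
  define w where "w j m = exp_kummer x \<nu> (Suc j) $ m * z ^ m" for j m
  have \<kappa>: "\<kappa> j = a j * \<Phi> j" for j by (simp only: \<kappa>_def a_def \<Phi>_def)
  have e: "e j = (\<Sum>i\<le>j. a i * w i (j - i))" for j
    by (simp only: e_def power_times_transform a_def w_def)
  have w: "suminf (w j) = exp z * \<Phi> j" for j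
    using exp_kummer_sums[of "Suc j" x \<nu> z] by (simp only: sums_iff w_def[abs_def] \<Phi>_def zero_less_Suc)
  have diff: "(\<lambda>N. (\<Sum>j\<le>N. e j) - exp z * (\<Sum>j\<le>N. \<kappa> j)) \<longlonglongrightarrow> 0" if "a \<longlonglongrightarrow> 0"
  proof -
    have "(\<lambda>N. (\<Sum>j\<le>N. \<Sum>i\<le>j. a i * w i (j - i)) - (\<Sum>i\<le>N. a i * suminf (w i))) \<longlonglongrightarrow> 0"
      by (rule convolution_partial_sums[OF that, where L = "(1 + (1 + norm \<nu>) * norm x) * norm z"])
         (auto simp only: w_def intro!: norm_exp_kummer_le mult_nonneg_nonneg add_nonneg_nonneg, auto)
    then show ?thesis
      by (simp only: e w \<kappa> sum_distrib_left mult_ac)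
  qed
  have from_\<kappa>: "e sums (exp z * suminf \<kappa>)" if "summable \<kappa>"
  proof -
    have \<Phi>: "\<Phi> \<longlonglongrightarrow> exp (\<nu> * (- x * z))"
      unfolding \<Phi>_def[abs_def] by (rule LIMSEQ_Suc[OF conf_hyp_tendsto_exp])
    \<comment> \<open>Early factors \<open>\<Phi> j\<close> may vanish, but their limit does not.\<close>
    have "(\<lambda>j. \<kappa> j / \<Phi> j) \<longlonglongrightarrow> 0 / exp (\<nu> * (- x * z))"
      by (intro tendsto_divide summable_LIMSEQ_zero that \<Phi>) simp
    moreover have "\<forall>\<^sub>F j in sequentially. \<kappa> j / \<Phi> j = a j"
      using tendsto_imp_eventually_ne[OF \<Phi> exp_not_eq_zero] by eventually_elim (auto simp: \<kappa>)
    ultimately have "a \<longlonglongrightarrow> 0" by (simp add: tendsto_cong)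
    from tendsto_add[OF diff[OF this] tendsto_mult_left[OF summable_LIMSEQ'[OF that], of "exp z"]]
    have "(\<lambda>N. \<Sum>j\<le>N. e j) \<longlonglongrightarrow> 0 + exp z * suminf \<kappa>" by simp
    then show ?thesis by (simp add: sums_def_le)
  qed
  have from_e: "summable \<kappa>" if "summable e"
  proof -
    have "a \<longlonglongrightarrow> 0"
    proof -
      \<comment> \<open>The row index of the dual coefficient is written as \<open>k + (n - k)\<close> to make it a function of
        the two indices of a convolution.\<close>
      have "(\<lambda>n. \<Sum>k\<le>n. e k * (exp_kummer_dual x \<nu> (Suc (k + (n - k))) $ (n - k) * z ^ (n - k))) \<longlonglongrightarrow> 0"
        by (rule convolution_tendsto_0[OF summable_LIMSEQ_zero[OF that] norm_exp_kummer_dual_le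
              summable_power_div_fact])
      moreover have "(\<Sum>k\<le>n. e k * (exp_kummer_dual x \<nu> (Suc (k + (n - k))) $ (n - k) * z ^ (n - k)))
          = dual_transform x \<nu> (kummer_transform x \<nu> t) n * z ^ Suc n" for n
        unfolding power_times_transform e_def by (intro sum.cong refl) simp
      ultimately show ?thesis
        by (simp only: dual_transform_kummer_transform a_def[abs_def])
    qed
    from tendsto_diff[OF summable_LIMSEQ'[OF that] diff[OF this]]
    have "(\<lambda>N. exp z * (\<Sum>j\<le>N. \<kappa> j)) \<longlonglongrightarrow> suminf e" by simp
    from tendsto_mult_left[OF this, of "inverse (exp z)"]
    have "(\<lambda>N. \<Sum>j\<le>N. \<kappa> j) \<longlonglongrightarrow> inverse (exp z) * suminf e"
      by (simp add: mult.assoc[symmetric])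
    then show ?thesis by (auto simp: summable_def sums_def_le)
  qed
  show "summable e \<longleftrightarrow> summable \<kappa>"
    using from_\<kappa> from_e sums_summable by blast
  show "suminf e = exp z * suminf \<kappa>" if "summable e"
    using from_\<kappa>[OF from_e[OF that]] by (simp add: sums_iff)
qed

lemma lt_mat_vec_B_mat:
  "lt_mat_vec (B_mat x \<nu>) T (Suc n) / fact (Suc n)
     = kummer_transform x \<nu> (\<lambda>j. (-1) ^ Suc j * T (Suc j) / fact (Suc j)) n"
proof -
  have "lt_mat_vec (B_mat x \<nu>) T (Suc n) = (\<Sum>k\<le>n. B_mat x \<nu> (Suc n) (Suc k) * T (Suc k))"
    unfolding lt_mat_vec_def One_nat_def sum.shift_bounds_cl_Suc_ivl atLeast0AtMost ..
  then show ?thesis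
    by (simp add: kummer_transform_def B_mat_eq sum_divide_distrib mult_ac del: fact_Suc power_Suc)
qed

lemma lt_mat_vec_A_mat:
  "(-1) ^ Suc n * lt_mat_vec (A_mat x \<nu>) S (Suc n) / fact (Suc n)
     = dual_transform x \<nu> (\<lambda>j. S (Suc j) / fact (Suc j)) n"
proof -
  have "lt_mat_vec (A_mat x \<nu>) S (Suc n) = (\<Sum>k\<le>n. A_mat x \<nu> (Suc n) (Suc k) * S (Suc k))"
    unfolding lt_mat_vec_def One_nat_def sum.shift_bounds_cl_Suc_ivl atLeast0AtMost ..
  then show ?thesis
    by (simp add: dual_transform_def A_mat_eq sum_divide_distrib sum_distrib_left mult_ac
          del: fact_Suc power_Suc)
qed

theorem corollary3p3:
  fixes x \<nu> :: complex and S T :: "nat \<Rightarrow> complex"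
  assumes "(\<forall>n\<ge>1. S n = lt_mat_vec (B_mat x \<nu>) T n) \<or> (\<forall>n\<ge>1. T n = lt_mat_vec (A_mat x \<nu>) S n)"
  shows "(summable (fps_kummer_term x \<nu> T) \<and>
          fps_egf S = fps_exp 1 * (\<Sum>j. fps_kummer_term x \<nu> T j)) \<and>
         (\<forall>z. (summable (egf_term S z) \<longleftrightarrow> summable (kummer_term x \<nu> T z)) \<and>
              (summable (egf_term S z) \<longrightarrow> egf S z = exp z * (\<Sum>j. kummer_term x \<nu> T z j)))"
proof -
  define s where "s j = S (Suc j) / fact (Suc j)" for j
  define t where "t j = (-1) ^ Suc j * T (Suc j) / fact (Suc j)" for j
  have s: "s = kummer_transform x \<nu> t"
    using assms
  proof
    assume "\<forall>n\<ge>1. S n = lt_mat_vec (B_mat x \<nu>) T n"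
    then have "S (Suc j) = lt_mat_vec (B_mat x \<nu>) T (Suc j)" for j by simp
    then show ?thesis
      unfolding s_def[abs_def] t_def[abs_def] by (simp only: lt_mat_vec_B_mat)
  next
    assume "\<forall>n\<ge>1. T n = lt_mat_vec (A_mat x \<nu>) S n"
    then have "T (Suc j) = lt_mat_vec (A_mat x \<nu>) S (Suc j)" for j by simp
    then have "t = dual_transform x \<nu> s"
      unfolding s_def[abs_def] t_def[abs_def] by (simp only: lt_mat_vec_A_mat)
    then show ?thesis by (simp add: kummer_transform_dual_transform)
  qed
  have "fps_egf S = Abs_fps (\<lambda>n. if n = 0 then 0 else s (n - 1))"
    by (simp add: fps_egf_def s_def del: fact_Suc cong: if_cong)
  then have formal: "fps_egf S = fps_exp 1 * (\<Sum>j. fps_kummer_term x \<nu> T j)"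
    unfolding fps_kummer_sums s t_def[abs_def] .
  have "egf_term S z = (\<lambda>j. kummer_transform x \<nu> t j * z ^ Suc j)" for z
    by (simp add: egf_term_def Let_def s_def fun_eq_iff flip: s del: fact_Suc)
  moreover have "kummer_term x \<nu> T z
      = (\<lambda>j. t j * z ^ Suc j * conf_hyp (of_nat (Suc j) * \<nu>) (of_nat (Suc j)) (- x * z))" for z
    by (simp add: kummer_term_def Let_def t_def fun_eq_iff del: fact_Suc power_Suc of_nat_Suc)
  ultimately show ?thesis
    using fps_kummer_sums(1) formal kummer_transform_summable_iff
    by (simp only: egf_def) blast
qed

end
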